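(* Let $S\ge 1$, $\alpha\ge 0$, $\beta\ge 0$ be integers with $\alpha+\beta\ge 1$, and consider the traditional Pólya urn started from $\alpha$ red and $\beta$ white balls, in which each drawn ball is returned together with $S$ additional balls of the same color. Let $X_n$ be the number of red balls at time $n$, $\tau_n=\alpha+\beta+nS$, $M_n=X_n/\tau_n$, and let $M_\infty$ be the almost sure limit of $(M_n)$. Then $$\sqrt{n}\,\frac{M_\infty-M_n}{\sqrt{M_n(1-M_n)}}\;\xrightarrow[n\to\infty]{\mathcal{L}}\;\mathcal{N}(0,1),$$ where $\xrightarrow{\mathcal{L}}$ denotes convergence in distribution.
   Context: Traditional Pólya urn model: at time $0$ the urn contains $\alpha$ red balls and $\beta$ white balls. At each time $n\ge1$ one ball is drawn uniformly at random from the urn, its color is observed, and it is returned to the urn together with $S$ additional balls of the same color (the replacement matrix is $\begin{pmatrix} S & 0\\ 0 & S\end{pmatrix}$). Thus $X_n=\alpha+S\sum_{k=1}^n\varepsilon_k$, where, with $\mathcal{F}_n$ denoting the $\sigma$-algebra of the past up to time $n$, the conditional distribution of $\varepsilon_{n+1}$ given $\mathcal{F}_n$ is Bernoulli with parameter $M_n=X_n/\tau_n$, and $\tau_n=\alpha+\beta+nS$ is the total number of balls at time $n$. The process $(M_n)$ is a bounded martingale, hence converges almost surely and in every $L^p$, $p\ge1$, to a random variable $M_\infty$.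
   Formalization: The formal theorem assumes α ≥ 1 and β ≥ 1 instead of α, β ≥ 0 with α+β ≥ 1; if α = 0 or β = 0, then almost surely M_n = M_∞ is constantly 0 or 1, and the quotient is 0/0 for every n. *)

theory Defs
  imports "HOL-Probability.Probability"
begin

text \<open>
  The sequence \<^term>\<open>\<epsilon>\<close> records the colours of the drawn balls: \<open>\<epsilon> k \<omega>\<close> holds iff the
  \<open>k\<close>-th drawn ball is red, for \<open>k \<ge> 1\<close>. The value \<open>\<epsilon> 0\<close> is never used.
\<close>

definition red_balls :: "nat \<Rightarrow> nat \<Rightarrow> (nat \<Rightarrow> 'a \<Rightarrow> bool) \<Rightarrow> nat \<Rightarrow> 'a \<Rightarrow> nat" where
  "red_balls S \<alpha> \<epsilon> n \<omega> = \<alpha> + S * (\<Sum>k=1..n. of_bool (\<epsilon> k \<omega>))"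

definition total_balls :: "nat \<Rightarrow> nat \<Rightarrow> nat \<Rightarrow> nat \<Rightarrow> nat" where
  "total_balls S \<alpha> \<beta> n = \<alpha> + \<beta> + n * S"

definition red_fraction ::
    "nat \<Rightarrow> nat \<Rightarrow> nat \<Rightarrow> (nat \<Rightarrow> 'a \<Rightarrow> bool) \<Rightarrow> nat \<Rightarrow> 'a \<Rightarrow> real" where
  "red_fraction S \<alpha> \<beta> \<epsilon> n \<omega> = real (red_balls S \<alpha> \<epsilon> n \<omega>) / real (total_balls S \<alpha> \<beta> n)"

text \<open>The \<open>\<sigma>\<close>-algebra of the past up to time \<open>n\<close>, generated by the first \<open>n\<close> draws.\<close>

definition urn_past :: "'a measure \<Rightarrow> (nat \<Rightarrow> 'a \<Rightarrow> bool) \<Rightarrow> nat \<Rightarrow> 'a measure" where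
  "urn_past P \<epsilon> n =
     sigma (space P) {\<epsilon> k -` A \<inter> space P | k A. k \<in> {1..n}}"

text \<open>
  Drawing uniformly from the urn and replacing with \<open>S\<close> further balls of the drawn colour:
  given the past up to time \<open>n\<close>, the next draw is Bernoulli distributed, with the current
  fraction of red balls as (random) parameter.
\<close>

locale polya_urn = prob_space P for P :: "'a measure" +
  fixes S \<alpha> \<beta> :: nat and \<epsilon> :: "nat \<Rightarrow> 'a \<Rightarrow> bool"
  assumes draw_measurable: "\<And>k. k \<ge> 1 \<Longrightarrow> \<epsilon> k \<in> measurable P (count_space UNIV)"
    and draw_cond_distr: "\<And>n A. AE \<omega> in P.
          real_cond_exp P (urn_past P \<epsilon> n) (indicator {\<omega>' \<in> space P. \<epsilon> (Suc n) \<omega>' \<in> A}) \<omega> =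
          measure_pmf.prob (bernoulli_pmf (red_fraction S \<alpha> \<beta> \<epsilon> n \<omega>)) A"

end

theory Submission
  imports Defs
begin

text \<open>
  The tail increments \<open>M\<^sub>k\<^sub>+\<^sub>1 - M\<^sub>k\<close>, \<open>k \<ge> n\<close>, are centred, bounded by \<open>s\<^sub>k = S / \<tau>\<^sub>k\<^sub>+\<^sub>1\<close>, and have
  conditional variance \<open>s\<^sub>k\<^sup>2 V\<^sub>k\<close> with \<open>V\<^sub>k = M\<^sub>k (1 - M\<^sub>k)\<close>, where \<open>\<Sum>\<^sub>k\<^sub>\<ge>\<^sub>n s\<^sub>k\<^sup>2 \<sim> 1 / n\<close>. With the
  random frequency \<open>u = t \<surd>n / \<surd>V\<^sub>n\<close>, known at time \<open>n\<close>, the numbers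
  \<open>\<phi>\<^sub>k = E [exp (i u (M\<^sub>k - M\<^sub>n)); V\<^sub>n \<ge> \<delta>]\<close> satisfy \<open>\<phi>\<^sub>k\<^sub>+\<^sub>1 = exp (- t\<^sup>2 n s\<^sub>k\<^sup>2 / 2) \<phi>\<^sub>k\<close> up to errors
  that sum to \<open>O(1 / \<surd>n)\<close>: replacing \<open>V\<^sub>k\<close> by \<open>V\<^sub>n\<close> costs only \<open>E \<bar>M\<^sub>k - M\<^sub>n\<bar> \<le> 1 / \<surd>n\<close>.
  Letting \<open>k \<rightarrow> \<infinity>\<close> turns \<open>M\<^sub>k\<close> into \<open>M\<^sub>\<infinity>\<close>. The event \<open>V\<^sub>n < \<delta>\<close> is uniformly unlikely for small
  \<open>\<delta>\<close>, by Markov's inequality for a supermartingale dominating \<open>- ln V\<^sub>n\<close>, and Levy's continuity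
  theorem concludes.
\<close>

section \<open>Taylor estimates for the centred Bernoulli characteristic function\<close>

text \<open>The lower side is convexity. For the upper side, \<open>exp c\<close> is at least its
  quadratic Taylor polynomial, and
  \<open>(1 - c + c^2 / 2) * (1 + c + c^2 / 2) = 1 + c^4 / 4\<close> bounds the reciprocal of that
  polynomial.\<close>

lemma exp_minus_taylor1_bound:
  fixes c :: real
  assumes "0 \<le> c"
  shows "\<bar>1 - c - exp (- c)\<bar> \<le> c\<^sup>2 / 2"
proof -
  have pos: "0 < 1 + c + c\<^sup>2 / 2" using assms by (simp add: add_pos_nonneg)
  have "exp (- c) \<le> 1 / (1 + c + c\<^sup>2 / 2)"
    using exp_lower_Taylor_quadratic[OF assms] pos
    by (simp add: exp_minus inverse_eq_divide frac_le)
  also have "\<dots> \<le> 1 - c + c\<^sup>2 / 2"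
  proof -
    have "(1 - c + c\<^sup>2 / 2) * (1 + c + c\<^sup>2 / 2) = 1 + (c\<^sup>2)\<^sup>2 / 4"
      by (simp add: algebra_simps power2_eq_square)
    then have "1 \<le> (1 - c + c\<^sup>2 / 2) * (1 + c + c\<^sup>2 / 2)" by simp
    then show ?thesis using pos by (simp add: divide_le_eq)
  qed
  finally have "exp (- c) \<le> 1 - c + c\<^sup>2 / 2" .
  moreover have "1 - c \<le> exp (- c)" using exp_ge_add_one_self[of "- c"] by simp
  ultimately show ?thesis by simp
qed

text \<open>The two exponentials average to the characteristic function at \<open>y\<close> of a
  Bernoulli variable minus its mean \<open>p\<close>. Centring cancels the linear terms, the
  quadratic ones add up to the variance, and each remainder is cubic in a displacement of size at
  most \<open>\<bar>y\<bar>\<close>.\<close>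

lemma centred_bernoulli_char_taylor2:
  fixes p y :: real
  assumes "0 \<le> p" "p \<le> 1"
  shows "cmod (p *\<^sub>R iexp (y * (1 - p)) + (1 - p) *\<^sub>R iexp (- (y * p))
    - of_real (1 - y\<^sup>2 * (p * (1 - p)) / 2)) \<le> \<bar>y\<bar> ^ 3 / 6"
proof -
  define R where "R x = iexp x - (1 + \<i> * of_real x - of_real (x\<^sup>2 / 2))" for x :: real
  have R: "cmod (R x) \<le> \<bar>x\<bar> ^ 3 / 6" for x
    using iexp_approx1[of x 2]
    by (simp add: R_def eval_nat_numeral field_simps)
  have "p *\<^sub>R iexp (y * (1 - p)) + (1 - p) *\<^sub>R iexp (- (y * p))
      - (p *\<^sub>R R (y * (1 - p)) + (1 - p) *\<^sub>R R (- (y * p)))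
      = of_real (p * (1 - (y * (1 - p))\<^sup>2 / 2) + (1 - p) * (1 - (y * p)\<^sup>2 / 2))"
    by (simp add: R_def scaleR_conv_of_real algebra_simps)
  also have "p * (1 - (y * (1 - p))\<^sup>2 / 2) + (1 - p) * (1 - (y * p)\<^sup>2 / 2)
      = 1 - y\<^sup>2 * (p * (1 - p)) / 2"
    by algebra
  finally have "p *\<^sub>R iexp (y * (1 - p)) + (1 - p) *\<^sub>R iexp (- (y * p))
      - of_real (1 - y\<^sup>2 * (p * (1 - p)) / 2) = p *\<^sub>R R (y * (1 - p)) + (1 - p) *\<^sub>R R (- (y * p))"
    by (simp add: algebra_simps)
  also have "cmod \<dots> \<le> cmod (p *\<^sub>R R (y * (1 - p))) + cmod ((1 - p) *\<^sub>R R (- (y * p)))"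
    by (rule norm_triangle_ineq)
  also have "\<dots> = p * cmod (R (y * (1 - p))) + (1 - p) * cmod (R (- (y * p)))"
    using assms by simp
  also have "\<dots> \<le> p * (\<bar>y\<bar> ^ 3 / 6) + (1 - p) * (\<bar>y\<bar> ^ 3 / 6)"
  proof (intro add_mono mult_left_mono)
    have "\<bar>y * (1 - p)\<bar> ^ 3 \<le> \<bar>y\<bar> ^ 3" "\<bar>- (y * p)\<bar> ^ 3 \<le> \<bar>y\<bar> ^ 3"
      using assms by (auto intro!: power_mono simp: abs_mult mult_left_le)
    then show "cmod (R (y * (1 - p))) \<le> \<bar>y\<bar> ^ 3 / 6" "cmod (R (- (y * p))) \<le> \<bar>y\<bar> ^ 3 / 6"
      using R[of "y * (1 - p)"] R[of "- (y * p)"] by linarith+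
  qed (use assms in auto)
  also have "\<dots> = \<bar>y\<bar> ^ 3 / 6" by (simp add: field_simps)
  finally show ?thesis .
qed

text \<open>Three replacements, one error term each: the Taylor polynomial, the variance
  \<open>p * (1 - p)\<close> by \<open>v\<close>, and \<open>1 - c\<close> by
  \<open>exp (- c)\<close>. It is applied with \<open>p\<close> the current fraction
  \<open>M k\<close> and \<open>v\<close> the earlier variance \<open>V n\<close>.\<close>

lemma centred_bernoulli_char_approx:
  fixes p y v :: real
  assumes "0 \<le> p" "p \<le> 1" "0 \<le> v"
  shows "cmod (p *\<^sub>R iexp (y * (1 - p)) + (1 - p) *\<^sub>R iexp (- (y * p))
    - of_real (exp (- (y\<^sup>2 * v / 2))))
    \<le> \<bar>y\<bar> ^ 3 / 6 + y\<^sup>2 / 2 * \<bar>p * (1 - p) - v\<bar> + (y\<^sup>2 * v / 2)\<^sup>2 / 2"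
proof -
  let ?A = "p *\<^sub>R iexp (y * (1 - p)) + (1 - p) *\<^sub>R iexp (- (y * p))"
  let ?b = "1 - y\<^sup>2 * (p * (1 - p)) / 2" and ?c = "1 - y\<^sup>2 * v / 2"
    and ?d = "exp (- (y\<^sup>2 * v / 2))"
  have "cmod (?A - of_real ?d) = cmod ((?A - of_real ?b) + of_real (?b - ?c) + of_real (?c - ?d))"
    by (simp only: of_real_diff[of ?b ?c] of_real_diff[of ?c ?d] add_diff_eq diff_add_cancel)
  also have "\<dots> \<le> cmod (?A - of_real ?b) + cmod (of_real (?b - ?c)) + cmod (of_real (?c - ?d))"
    by (intro order_trans[OF norm_triangle_ineq] add_mono order_refl norm_triangle_ineq)
  also have "\<dots> \<le> \<bar>y\<bar> ^ 3 / 6 + y\<^sup>2 / 2 * \<bar>p * (1 - p) - v\<bar> + (y\<^sup>2 * v / 2)\<^sup>2 / 2"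
  proof (intro add_mono)
    show "cmod (?A - of_real ?b) \<le> \<bar>y\<bar> ^ 3 / 6"
      by (rule centred_bernoulli_char_taylor2) fact+
    have "?b - ?c = y\<^sup>2 / 2 * (v - p * (1 - p))" by (simp add: field_simps)
    then have "\<bar>?b - ?c\<bar> = y\<^sup>2 / 2 * \<bar>p * (1 - p) - v\<bar>"
      by (simp only: abs_mult) (simp add: abs_minus_commute)
    then show "cmod (of_real (?b - ?c)) \<le> y\<^sup>2 / 2 * \<bar>p * (1 - p) - v\<bar>"
      by (simp only: norm_of_real)
    show "cmod (of_real (?c - ?d)) \<le> (y\<^sup>2 * v / 2)\<^sup>2 / 2"
      using exp_minus_taylor1_bound[of "y\<^sup>2 * v / 2"] assms by (simp only: norm_of_real) simp
  qed
  finally show ?thesis .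
qed

text \<open>This turns the cost of freezing the variance at time \<open>n\<close> into the increment
  of the red fraction since then.\<close>

lemma bernoulli_variance_lipschitz:
  fixes x y :: real
  assumes "0 \<le> x" "x \<le> 1" "0 \<le> y" "y \<le> 1"
  shows "\<bar>x * (1 - x) - y * (1 - y)\<bar> \<le> \<bar>x - y\<bar>"
proof -
  have "x * (1 - x) - y * (1 - y) = (x - y) * (1 - x - y)" by (simp add: algebra_simps)
  moreover have "\<bar>1 - x - y\<bar> \<le> 1" using assms by auto
  ultimately show ?thesis by (simp add: abs_mult mult_left_le)
qed

lemma norm_integral_le:
  fixes f :: "'a \<Rightarrow> 'b::{banach, second_countable_topology}"
  assumes "integrable N f" "integrable N g" "\<And>x. x \<in> space N \<Longrightarrow> norm (f x) \<le> g x"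
  shows "norm (\<integral>x. f x \<partial>N) \<le> (\<integral>x. g x \<partial>N)"
  by (rule order_trans[OF integral_norm_bound integral_mono]) (use assms in auto)

section \<open>Accumulation of one-step errors\<close>

text \<open>The factors \<open>exp (- c k)\<close> are at most 1, so earlier errors are never
  amplified and simply add up.\<close>

lemma perturbed_geometric_recursion:
  fixes z :: "nat \<Rightarrow> complex"
  assumes step: "\<And>k. n \<le> k \<Longrightarrow> cmod (z (Suc k) - of_real (exp (- c k)) * z k) \<le> e k"
    and c: "\<And>k. 0 \<le> c k" and "n \<le> N"
  shows "cmod (z N - of_real (exp (- (\<Sum>k=n..<N. c k))) * z n) \<le> (\<Sum>k=n..<N. e k)"
  using \<open>n \<le> N\<close>
proof (induction N rule: dec_induct)
  case base
  then show ?case by simp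
next
  case (step N)
  let ?E = "of_real (exp (- (\<Sum>k=n..<N. c k))) * z n"
  have "z (Suc N) - of_real (exp (- (\<Sum>k=n..<Suc N. c k))) * z n
      = (z (Suc N) - of_real (exp (- c N)) * z N) + of_real (exp (- c N)) * (z N - ?E)"
    using step.hyps by (simp add: exp_add[symmetric] right_diff_distrib mult.assoc[symmetric]
        of_real_mult[symmetric] del: of_real_mult)
  also have "cmod \<dots> \<le> cmod (z (Suc N) - of_real (exp (- c N)) * z N)
      + exp (- c N) * cmod (z N - ?E)"
    by (intro order_trans[OF norm_triangle_ineq]) (simp add: norm_mult)
  also have "\<dots> \<le> e N + 1 * (\<Sum>k=n..<N. e k)"
    using step assms(1)[of N] c by (intro add_mono mult_mono) auto
  finally show ?case using step.hyps by simp
qed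

text \<open>The three terms come from the cubic remainder, the change of variance and the linearised
  exponential, for frequencies bounded by \<open>b * sqrt n\<close>.\<close>

definition char_error_const :: "real \<Rightarrow> real" where
  "char_error_const b = b ^ 3 / 6 + b\<^sup>2 / 2 + b ^ 4 / 8"

text \<open>Here \<open>s\<close> is a step size and \<open>e\<close> stands for the mean absolute
  increment. Using \<open>n * s \<le> 1\<close> and \<open>e \<le> 1 / sqrt n\<close>, every term is
  reduced to a multiple of \<open>s\<^sup>2 * sqrt n\<close>. As the squared steps sum to at most
  \<open>1 / n\<close>, the total is of order \<open>1 / sqrt n\<close>.\<close>

lemma characteristic_error_le:
  fixes b s t n :: real
  assumes n: "1 \<le> n" and s: "0 \<le> s" "s \<le> 1 / n" and e: "e \<le> 1 / sqrt n" and t: "\<bar>t\<bar> \<le> b"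
  shows "(b * sqrt n) ^ 3 * s ^ 3 / 6 + (b * sqrt n)\<^sup>2 * s\<^sup>2 / 2 * e + (t\<^sup>2 * n * s\<^sup>2 / 2)\<^sup>2 / 2
    \<le> s\<^sup>2 * (sqrt n * char_error_const b)"
proof -
  define r where "r = sqrt n"
  have r: "1 \<le> r" "n = r\<^sup>2" using n by (auto simp: r_def)
  have b: "0 \<le> b" using t by simp
  have ns: "n * s \<le> 1" "0 \<le> n * s" using s n by (auto simp: field_simps)
  have "(b * r) ^ 3 * s ^ 3 / 6 = s\<^sup>2 * (r * (b ^ 3 / 6)) * (n * s)"
    by (simp add: r(2) power_mult_distrib eval_nat_numeral)
  also have "\<dots> \<le> s\<^sup>2 * (r * (b ^ 3 / 6))" using ns b r by (intro mult_left_le) auto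
  finally have 1: "(b * r) ^ 3 * s ^ 3 / 6 \<le> s\<^sup>2 * (r * (b ^ 3 / 6))" .
  have "(b * r)\<^sup>2 * s\<^sup>2 / 2 * e \<le> (b * r)\<^sup>2 * s\<^sup>2 / 2 * (1 / r)"
    using e by (intro mult_left_mono) (auto simp: r_def)
  also have "\<dots> = s\<^sup>2 * (r * (b\<^sup>2 / 2))" using r by (simp add: power2_eq_square)
  finally have 2: "(b * r)\<^sup>2 * s\<^sup>2 / 2 * e \<le> s\<^sup>2 * (r * (b\<^sup>2 / 2))" .
  have "t\<^sup>2 \<le> b\<^sup>2" using power_mono[OF t, of 2] by simp
  then have "(t\<^sup>2)\<^sup>2 \<le> (b\<^sup>2)\<^sup>2" by (rule power_mono) simp
  moreover have "(n * s)\<^sup>2 \<le> 1\<^sup>2" using ns by (intro power_mono) auto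
  \<comment> \<open>The generous factor \<open>r \<ge> 1\<close> gives this term the same shape as
    the other two.\<close>
  ultimately have "(t\<^sup>2)\<^sup>2 * (n * s)\<^sup>2 \<le> (b\<^sup>2)\<^sup>2 * r" using r(1) by (intro mult_mono) auto
  then have "s\<^sup>2 / 8 * ((t\<^sup>2)\<^sup>2 * (n * s)\<^sup>2) \<le> s\<^sup>2 / 8 * ((b\<^sup>2)\<^sup>2 * r)" by (intro mult_left_mono) auto
  moreover have "(t\<^sup>2 * n * s\<^sup>2 / 2)\<^sup>2 / 2 = s\<^sup>2 / 8 * ((t\<^sup>2)\<^sup>2 * (n * s)\<^sup>2)"
    by (simp add: power2_eq_square)
  moreover have "s\<^sup>2 / 8 * ((b\<^sup>2)\<^sup>2 * r) = s\<^sup>2 * (r * (b ^ 4 / 8))" by (simp add: eval_nat_numeral)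
  ultimately have 3: "(t\<^sup>2 * n * s\<^sup>2 / 2)\<^sup>2 / 2 \<le> s\<^sup>2 * (r * (b ^ 4 / 8))" by (simp only:)
  show ?thesis using 1 2 3 by (simp add: r_def char_error_const_def distrib_left)
qed

lemma exp_minus_lipschitz:
  fixes a b :: real
  assumes "0 \<le> a" "a \<le> b"
  shows "\<bar>exp (- a) - exp (- b)\<bar> \<le> b - a"
proof -
  have "exp (- a) - exp (- b) = exp (- a) * (1 - exp (- (b - a)))"
    by (simp add: right_diff_distrib exp_add[symmetric])
  also have "\<dots> \<le> 1 * (b - a)"
  proof (rule mult_mono)
    show "1 - exp (- (b - a)) \<le> b - a" using exp_ge_add_one_self[of "- (b - a)"] by linarith
  qed (use assms in auto)
  finally show ?thesis using assms by simp
qed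

section \<open>A logarithmic penalty for a rare colour\<close>

definition log_penalty :: "real \<Rightarrow> real \<Rightarrow> real \<Rightarrow> real" where
  "log_penalty s a t = s / a - ln (a / t)"

text \<open>The term \<open>s / a\<close> compensates the drift of \<open>- ln (a / t)\<close>, making the sum a supermartingale.\<close>

lemma log_penalty_drift:
  fixes x y s :: real
  assumes "0 < x" "0 < y" "0 < s"
  shows "x / (x + y) * log_penalty s (x + s) (x + y + s) + y / (x + y) * log_penalty s x (x + y + s)
    \<le> log_penalty s x (x + y)"
proof -
  let ?t = "x + y" and ?h = "log_penalty s"
  have t: "0 < ?t" using assms by simp
  have y: "y / ?t = 1 - x / ?t" using t by (simp add: field_simps)
  have l: "?h a b = s / a - ln a + ln b" if "0 < a" "0 < b" for a b
    using that by (simp add: log_penalty_def ln_div)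
  have "ln (?t + s) - ln ?t = ln ((?t + s) / ?t)" using t assms by (simp add: ln_div)
  also have "\<dots> = ln (1 + s / ?t)" using t by (simp add: add_divide_distrib)
  also have "\<dots> \<le> s / ?t" using t assms by (intro ln_add_one_self_le_self) auto
  finally have 1: "ln (?t + s) - ln ?t \<le> s / ?t" .
  have "ln x - ln (x + s) = ln (x / (x + s))" using assms by (simp add: ln_div)
  also have "x / (x + s) = 1 + - s / (x + s)" using assms by (simp add: field_simps)
  also have "ln \<dots> \<le> - s / (x + s)"
    using assms by (intro ln_add_one_self_le_self2) (auto simp: field_simps)
  finally have 2: "s / (x + s) \<le> ln (x + s) - ln x" by simp
  have "x / ?t * ?h (x + s) (?t + s) + y / ?t * ?h x (?t + s) - ?h x ?t
      = (ln (?t + s) - ln ?t) - x / ?t * (ln (x + s) - ln x) + x / ?t * (s / (x + s) - s / x)"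
    using assms t unfolding y by (subst (1 2 3) l) (auto simp: algebra_simps)
  \<comment> \<open>The terms in \<open>s / (x + s)\<close> now cancel, and the compensator leaves
    \<open>x / ?t * (s / x)\<close>, which is exactly the bound \<open>s / ?t\<close> on the growth
    of the logarithm of the total.\<close>
  also have "\<dots> \<le> s / ?t - x / ?t * (s / (x + s)) + x / ?t * (s / (x + s) - s / x)"
    using 1 2 t assms by (intro add_mono diff_mono mult_left_mono) auto
  also have "\<dots> = s / ?t - x / ?t * (s / x)" by (simp add: algebra_simps)
  also have "\<dots> = 0" using assms by simp
  finally show ?thesis by simp
qed

text \<open>Ball counts are at least 1, so both logarithm and compensator are controlled. The first
  two bounds serve Markov's inequality, the third integrability at a fixed time.\<close>

lemma log_penalty_bounds:
  assumes "0 < s" "1 \<le> a" "a \<le> t"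
  shows "- ln (a / t) \<le> log_penalty s a t" "0 \<le> log_penalty s a t" "log_penalty s a t \<le> s + ln t"
proof -
  have "s / a \<le> s / 1" using assms by (intro divide_left_mono) auto
  moreover have "ln (a / t) \<le> 0" "- ln (a / t) \<le> ln t" "0 \<le> s / a"
    using assms by (auto simp: ln_div)
  ultimately show "- ln (a / t) \<le> log_penalty s a t" "0 \<le> log_penalty s a t"
      "log_penalty s a t \<le> s + ln t"
    by (simp_all add: log_penalty_def)
qed

section \<open>Filtration of the urn and averaging over the next draw\<close>

context polya_urn
begin

abbreviation "M \<equiv> red_fraction S \<alpha> \<beta> \<epsilon>"
abbreviation "past \<equiv> urn_past P \<epsilon>"

lemma urn_past_generator: "{\<epsilon> k -` A \<inter> space P | k A. k \<in> {1..n}} \<subseteq> Pow (space P)"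
  by auto

lemma space_past [simp]: "space (past n) = space P"
  unfolding urn_past_def by (rule space_measure_of[OF urn_past_generator])

lemma sets_past: "sets (past n) = sigma_sets (space P) {\<epsilon> k -` A \<inter> space P | k A. k \<in> {1..n}}"
  unfolding urn_past_def by (rule sets_measure_of[OF urn_past_generator])

lemma subalgebra_past: "subalgebra P (past n)"
  unfolding subalgebra_def sets_past
  using draw_measurable
  by (auto intro!: sets.sigma_sets_subset measurable_sets)

lemma subalgebra_past_mono: "m \<le> n \<Longrightarrow> subalgebra (past n) (past m)"
  unfolding subalgebra_def sets_past by (simp, intro sigma_sets_mono', fastforce)

lemma draw_measurable_past:
  assumes "1 \<le> k" "k \<le> n"
  shows "\<epsilon> k \<in> measurable (past n) (count_space UNIV)"
proof (rule measurableI)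
  fix A :: "bool set"
  show "\<epsilon> k -` A \<inter> space (past n) \<in> sets (past n)"
    unfolding sets_past using assms by (auto intro!: sigma_sets.Basic)
qed simp

lemma red_fraction_measurable_past:
  assumes "m \<le> n"
  shows "M m \<in> borel_measurable (past n)"
proof -
  have "Measurable.pred (past n) (\<epsilon> k)" if "k \<in> {1..m}" for k
    using draw_measurable_past[of k n] that assms by auto
  then have "(\<lambda>\<omega>. of_bool (\<epsilon> k \<omega>) :: real) \<in> borel_measurable (past n)" if "k \<in> {1..m}" for k
    using that by measurable
  then have "(\<lambda>\<omega>. \<Sum>k=1..m. of_bool (\<epsilon> k \<omega>) :: real) \<in> borel_measurable (past n)"
    by (intro borel_measurable_sum)
  then show ?thesis
    unfolding red_fraction_def red_balls_def by (simp add: of_nat_of_bool)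
qed

lemma red_fraction_measurable [measurable]: "M n \<in> borel_measurable P"
  using measurable_from_subalg[OF subalgebra_past red_fraction_measurable_past] by blast

lemma draw_measurable_Suc [measurable]: "Measurable.pred P (\<epsilon> (Suc n))"
  using draw_measurable[of "Suc n"] by simp

lemma red_balls_Suc: "red_balls S \<alpha> \<epsilon> (Suc n) \<omega> = red_balls S \<alpha> \<epsilon> n \<omega> + S * of_bool (\<epsilon> (Suc n) \<omega>)"
  by (simp add: red_balls_def algebra_simps)

lemma red_balls_bounds:
  "\<alpha> \<le> red_balls S \<alpha> \<epsilon> n \<omega>" "red_balls S \<alpha> \<epsilon> n \<omega> + \<beta> \<le> total_balls S \<alpha> \<beta> n"
proof -
  show "\<alpha> \<le> red_balls S \<alpha> \<epsilon> n \<omega>" by (simp add: red_balls_def)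
  have "(\<Sum>k=1..n. of_bool (\<epsilon> k \<omega>) :: nat) \<le> (\<Sum>k=1..n. 1)" by (intro sum_mono) auto
  then have "S * (\<Sum>k=1..n. of_bool (\<epsilon> k \<omega>)) \<le> S * n" by (intro mult_left_mono) auto
  then show "red_balls S \<alpha> \<epsilon> n \<omega> + \<beta> \<le> total_balls S \<alpha> \<beta> n"
    by (simp add: red_balls_def total_balls_def mult.commute)
qed

lemma red_fraction_bounds: "0 \<le> M n \<omega>" "M n \<omega> \<le> 1"
proof -
  show "0 \<le> M n \<omega>" by (simp add: red_fraction_def)
  have "red_balls S \<alpha> \<epsilon> n \<omega> \<le> total_balls S \<alpha> \<beta> n"
    using red_balls_bounds(2)[of n \<omega>] by linarith
  then show "M n \<omega> \<le> 1" unfolding red_fraction_def by (intro divide_le_eq_1[THEN iffD2]) linarith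
qed

text \<open>The conditional law of the draw enters here. The integrand is \<open>g\<close> plus the
  past-measurable difference \<open>f - g\<close> times the indicator of a red draw, and that
  indicator has conditional expectation \<open>M n\<close>.\<close>

lemma integral_draw_real:
  fixes f g :: "'a \<Rightarrow> real"
  assumes f: "f \<in> borel_measurable (past n)" "integrable P f"
    and g: "g \<in> borel_measurable (past n)" "integrable P g"
  shows "(\<integral>\<omega>. (if \<epsilon> (Suc n) \<omega> then f \<omega> else g \<omega>) \<partial>P)
    = (\<integral>\<omega>. M n \<omega> * f \<omega> + (1 - M n \<omega>) * g \<omega> \<partial>P)"
proof -
  interpret F: finite_measure_subalgebra P "past n"
    by unfold_locales (rule subalgebra_past)
  \<comment> \<open>Membership in \<open>{True}\<close> is kept to match the form of
    \<open>draw_cond_distr\<close>.\<close>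
  define D where "D = {\<omega> \<in> space P. \<epsilon> (Suc n) \<omega> \<in> {True}}"
  have D[measurable]: "D \<in> sets P" unfolding D_def by simp measurable
  have ce: "AE \<omega> in P. real_cond_exp P (past n) (indicator D) \<omega> = M n \<omega>"
    using draw_cond_distr[of n "{True}"] red_fraction_bounds
    unfolding D_def by (simp add: measure_pmf_single del: singleton_iff)
  define d where "d \<omega> = f \<omega> - g \<omega>" for \<omega>
  have dm: "d \<in> borel_measurable (past n)" unfolding d_def using f g by measurable
  have di: "integrable P d" unfolding d_def using f g by auto
  have dD: "integrable P (\<lambda>\<omega>. d \<omega> * indicator D \<omega>)"
    using integrable_real_mult_indicator[OF D di] by (simp add: mult.commute)
  have Md: "integrable P (\<lambda>\<omega>. d \<omega> * M n \<omega>)"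
    by (rule Bochner_Integration.integrable_bound[OF di])
      (use di in \<open>auto simp: abs_mult mult_left_le red_fraction_bounds\<close>)
  have "(\<integral>\<omega>. (if \<epsilon> (Suc n) \<omega> then f \<omega> else g \<omega>) \<partial>P) = (\<integral>\<omega>. d \<omega> * indicator D \<omega> + g \<omega> \<partial>P)"
    by (intro Bochner_Integration.integral_cong) (auto simp: D_def d_def)
  also have "\<dots> = (\<integral>\<omega>. d \<omega> * indicator D \<omega> \<partial>P) + (\<integral>\<omega>. g \<omega> \<partial>P)"
    using dD g by simp
  also have "(\<integral>\<omega>. d \<omega> * indicator D \<omega> \<partial>P)
      = (\<integral>\<omega>. d \<omega> * real_cond_exp P (past n) (indicator D) \<omega> \<partial>P)"
    by (rule F.real_cond_exp_intg(2)[symmetric]) (use dD dm in auto)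
  also have "\<dots> = (\<integral>\<omega>. d \<omega> * M n \<omega> \<partial>P)"
    using ce di by (intro integral_cong_AE) auto
  also have "\<dots> + (\<integral>\<omega>. g \<omega> \<partial>P) = (\<integral>\<omega>. d \<omega> * M n \<omega> + g \<omega> \<partial>P)"
    using Md g by simp
  also have "\<dots> = (\<integral>\<omega>. M n \<omega> * f \<omega> + (1 - M n \<omega>) * g \<omega> \<partial>P)"
    by (intro Bochner_Integration.integral_cong) (auto simp: d_def algebra_simps)
  finally show ?thesis .
qed

lemma integrable_draw_average:
  fixes f g :: "'a \<Rightarrow> complex"
  assumes f: "integrable P f" and g: "integrable P g"
  shows "integrable P (\<lambda>\<omega>. M n \<omega> *\<^sub>R f \<omega> + (1 - M n \<omega>) *\<^sub>R g \<omega>)"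
proof (rule Bochner_Integration.integrable_add)
  show "integrable P (\<lambda>\<omega>. M n \<omega> *\<^sub>R f \<omega>)"
    by (rule Bochner_Integration.integrable_bound[OF f])
      (use f in \<open>auto simp: abs_mult mult_left_le_one_le red_fraction_bounds\<close>)
  show "integrable P (\<lambda>\<omega>. (1 - M n \<omega>) *\<^sub>R g \<omega>)"
    by (rule Bochner_Integration.integrable_bound[OF g])
      (use g in \<open>auto simp: abs_mult mult_left_le_one_le red_fraction_bounds\<close>)
qed

text \<open>The version for characteristic functions: \<open>real_cond_exp\<close> is real valued,
  so real and imaginary parts are averaged separately.\<close>

lemma integral_draw:
  fixes f g :: "'a \<Rightarrow> complex"
  assumes f[measurable]: "f \<in> borel_measurable (past n)" and fi: "integrable P f"
    and g[measurable]: "g \<in> borel_measurable (past n)" and gi: "integrable P g"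
  shows "(\<integral>\<omega>. (if \<epsilon> (Suc n) \<omega> then f \<omega> else g \<omega>) \<partial>P)
    = (\<integral>\<omega>. M n \<omega> *\<^sub>R f \<omega> + (1 - M n \<omega>) *\<^sub>R g \<omega> \<partial>P)"
proof -
  have [measurable]: "f \<in> borel_measurable P" "g \<in> borel_measurable P" using fi gi by auto
  have i: "integrable P (\<lambda>\<omega>. if \<epsilon> (Suc n) \<omega> then f \<omega> else g \<omega>)"
    by (rule Bochner_Integration.integrable_bound
          [OF Bochner_Integration.integrable_add[OF integrable_norm[OF fi] integrable_norm[OF gi]]]) auto
  note j = integrable_draw_average[OF fi gi]
  show ?thesis
  proof (rule complex_eqI)
    have "(\<integral>\<omega>. (if \<epsilon> (Suc n) \<omega> then Re (f \<omega>) else Re (g \<omega>)) \<partial>P)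
        = (\<integral>\<omega>. M n \<omega> * Re (f \<omega>) + (1 - M n \<omega>) * Re (g \<omega>) \<partial>P)"
      using fi gi by (intro integral_draw_real) measurable
    then show "Re (\<integral>\<omega>. (if \<epsilon> (Suc n) \<omega> then f \<omega> else g \<omega>) \<partial>P)
        = Re (\<integral>\<omega>. M n \<omega> *\<^sub>R f \<omega> + (1 - M n \<omega>) *\<^sub>R g \<omega> \<partial>P)"
      by (simp add: integral_Re[OF i, symmetric] integral_Re[OF j, symmetric] if_distrib[of Re]
          del: integral_Re)
    have "(\<integral>\<omega>. (if \<epsilon> (Suc n) \<omega> then Im (f \<omega>) else Im (g \<omega>)) \<partial>P)
        = (\<integral>\<omega>. M n \<omega> * Im (f \<omega>) + (1 - M n \<omega>) * Im (g \<omega>) \<partial>P)"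
      using fi gi by (intro integral_draw_real) measurable
    then show "Im (\<integral>\<omega>. (if \<epsilon> (Suc n) \<omega> then f \<omega> else g \<omega>) \<partial>P)
        = Im (\<integral>\<omega>. M n \<omega> *\<^sub>R f \<omega> + (1 - M n \<omega>) *\<^sub>R g \<omega> \<partial>P)"
      by (simp add: integral_Im[OF i, symmetric] integral_Im[OF j, symmetric] if_distrib[of Im]
          del: integral_Im)
  qed
qed

end

section \<open>Step sizes and moments of the increments\<close>

text \<open>Starting with both colours keeps \<open>V n\<close> positive at every time. With only
  one colour the fraction would almost surely stay at 0 or 1 and the normalised error would
  degenerate to 0 / 0.\<close>

locale two_coloured_urn = polya_urn +
  assumes S_pos: "0 < S" and red_pos: "0 < \<alpha>" and white_pos: "0 < \<beta>"
begin

abbreviation "V n \<omega> \<equiv> M n \<omega> * (1 - M n \<omega>)"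

text \<open>The total is measured in units of \<open>S\<close>, so that it grows by exactly 1 per
  draw. The move from time \<open>k\<close> to \<open>k + 1\<close> is governed by the total after
  the draw, hence the index \<open>Suc k\<close> in \<open>step k\<close>.\<close>

definition T :: "nat \<Rightarrow> real" where
  "T n = real (total_balls S \<alpha> \<beta> n) / real S"

abbreviation "step k \<equiv> 1 / T (Suc k)"

lemma T_pos: "0 < T n"
  using S_pos red_pos by (simp add: T_def total_balls_def add_pos_nonneg)

lemma T_eq: "T n = real n + T 0"
  using S_pos by (simp add: T_def total_balls_def field_simps)

lemma step_pos: "0 < step k"
  using T_pos[of "Suc k"] by simp

lemma step_le: "1 \<le> n \<Longrightarrow> n \<le> k \<Longrightarrow> step k \<le> 1 / real n"
  using T_pos[of 0] T_eq[of "Suc k"] by (intro divide_left_mono mult_pos_pos T_pos) auto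

text \<open>A draw moves the fraction by the proportion \<open>step k\<close> of its distance to 1
  or to 0. The increment is thus \<open>step k\<close> times a centred Bernoulli variable with
  parameter \<open>M k\<close>.\<close>

lemma red_fraction_Suc:
  "M (Suc k) \<omega> = (if \<epsilon> (Suc k) \<omega> then M k \<omega> + step k * (1 - M k \<omega>) else M k \<omega> - step k * M k \<omega>)"
proof -
  have "0 < real (total_balls S \<alpha> \<beta> k)" "0 < real (total_balls S \<alpha> \<beta> (Suc k))"
    using red_pos by (simp_all add: total_balls_def add_pos_nonneg)
  moreover have "real (total_balls S \<alpha> \<beta> (Suc k)) = total_balls S \<alpha> \<beta> k + real S"
    by (simp add: total_balls_def)
  ultimately show ?thesis
    using S_pos by (simp add: T_def red_fraction_def red_balls_Suc divide_simps) (simp add: algebra_simps)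
qed

text \<open>Since \<open>T (Suc k) \<ge> k + 1\<close>, the squares are dominated by the telescoping
  differences \<open>1 / k - 1 / (k + 1)\<close>.\<close>

lemma sum_step_squares_le:
  assumes "1 \<le> n" "n \<le> N"
  shows "(\<Sum>k=n..<N. (step k)\<^sup>2) \<le> 1 / real n"
proof -
  have "(\<Sum>k=n..<N. (step k)\<^sup>2) \<le> (\<Sum>k=n..<N. - 1 / real (Suc k) - - 1 / real k)"
  proof (rule sum_mono)
    fix k assume "k \<in> {n..<N}"
    then have k: "1 \<le> k" using assms by simp
    have "step k \<le> 1 / real (Suc k)"
      using T_pos[of 0] T_eq[of "Suc k"] by (intro divide_left_mono mult_pos_pos T_pos) auto
    then have "(step k)\<^sup>2 \<le> (1 / real (Suc k))\<^sup>2" using step_pos[of k] by (intro power_mono) auto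
    also have "\<dots> \<le> - 1 / real (Suc k) - - 1 / real k"
      using k by (simp add: divide_simps power2_eq_square)
    finally show "(step k)\<^sup>2 \<le> - 1 / real (Suc k) - - 1 / real k" .
  qed
  also have "\<dots> = 1 / real n - 1 / real N"
    using sum_Suc_diff'[OF assms(2), of "\<lambda>k. - 1 / real k"] by simp
  also have "\<dots> \<le> 1 / real n" by simp
  finally show ?thesis .
qed

text \<open>Telescoping \<open>1 / x - 1 / (x + 1) \<le> 1 / x^2\<close> with
  \<open>x = T (Suc k)\<close>. Together with the upper bound this shows that \<open>n\<close> times
  the tail sum of squares tends to 1.\<close>

lemma sum_step_squares_ge:
  assumes "n \<le> N"
  shows "step n - step N \<le> (\<Sum>k=n..<N. (step k)\<^sup>2)"
proof -
  have "step n - step N = (\<Sum>k=n..<N. - step (Suc k) - - step k)"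
    using sum_Suc_diff'[OF assms, of "\<lambda>k. - step k"] by simp
  also have "\<dots> \<le> (\<Sum>k=n..<N. (step k)\<^sup>2)"
  proof (rule sum_mono)
    fix k
    define x where "x = T (Suc k)"
    have "T (Suc (Suc k)) = x + 1" "0 < x"
      using T_eq[of "Suc k"] T_eq[of "Suc (Suc k)"] T_pos[of "Suc k"] by (auto simp: x_def)
    then show "- step (Suc k) - - step k \<le> (step k)\<^sup>2"
      unfolding x_def[symmetric] by (simp add: divide_simps power2_eq_square)
  qed
  finally show ?thesis .
qed

lemma integrable_bounded:
  fixes f :: "'a \<Rightarrow> 'b::{banach, second_countable_topology}"
  assumes "f \<in> borel_measurable P" "\<And>\<omega>. norm (f \<omega>) \<le> B"
  shows "integrable P f"
  using assms by (intro integrable_const_bound[where B = B]) auto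

lemma red_fraction_increment_le_1: "\<bar>M k \<omega> - M n \<omega>\<bar> \<le> 1"
  using red_fraction_bounds[of k \<omega>] red_fraction_bounds[of n \<omega>] by auto

lemma step_le_1: "step k \<le> 1"
  using T_eq[of "Suc k"] T_pos[of 0] by simp

text \<open>Orthogonality of martingale increments: each draw adds its conditional variance
  \<open>(step k)\<^sup>2 * V k\<close>, and \<open>V k \<le> 1\<close>.\<close>

lemma increment_second_moment:
  assumes "n \<le> k"
  shows "expectation (\<lambda>\<omega>. (M k \<omega> - M n \<omega>)\<^sup>2) \<le> (\<Sum>j=n..<k. (step j)\<^sup>2)"
  using assms
proof (induction k rule: dec_induct)
  case base
  then show ?case by simp
next
  case (step k)
  let ?d = "\<lambda>\<omega>. M k \<omega> - M n \<omega>"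
  have meas: "M n \<in> borel_measurable (past k)" "M k \<in> borel_measurable (past k)"
    using step.hyps by (auto intro: red_fraction_measurable_past)
  have b: "\<bar>?d \<omega>\<bar> \<le> 1" "\<bar>step k * (1 - M k \<omega>)\<bar> \<le> 1" "\<bar>step k * M k \<omega>\<bar> \<le> 1" for \<omega>
    using step_pos[of k] step_le_1[of k] red_fraction_bounds[of k \<omega>] red_fraction_increment_le_1
    unfolding abs_mult by (auto intro!: mult_le_one)
  have sq: "norm ((x + y)\<^sup>2) \<le> 4" "norm ((x - y)\<^sup>2) \<le> 4" if "\<bar>x\<bar> \<le> 1" "\<bar>y\<bar> \<le> 1" for x y :: real
    using power_mono[of "\<bar>x + y\<bar>" 2 2] power_mono[of "\<bar>x - y\<bar>" 2 2] that by auto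
  have i1: "integrable P (\<lambda>\<omega>. (?d \<omega> + step k * (1 - M k \<omega>))\<^sup>2)"
  proof (rule integrable_bounded[where B = 4])
    show "norm ((?d \<omega> + step k * (1 - M k \<omega>))\<^sup>2) \<le> 4" for \<omega>
      by (rule sq) (rule b)+
  qed measurable
  have i2: "integrable P (\<lambda>\<omega>. (?d \<omega> - step k * M k \<omega>)\<^sup>2)"
  proof (rule integrable_bounded[where B = 4])
    show "norm ((?d \<omega> - step k * M k \<omega>)\<^sup>2) \<le> 4" for \<omega>
      by (rule sq) (rule b)+
  qed measurable
  have id: "integrable P (\<lambda>\<omega>. (?d \<omega>)\<^sup>2)"
    by (rule integrable_bounded[where B = 1]) (use b(1) in \<open>auto simp: abs_square_le_1\<close>)
  have "expectation (\<lambda>\<omega>. (M (Suc k) \<omega> - M n \<omega>)\<^sup>2)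
      = expectation (\<lambda>\<omega>. if \<epsilon> (Suc k) \<omega> then (?d \<omega> + step k * (1 - M k \<omega>))\<^sup>2
          else (?d \<omega> - step k * M k \<omega>)\<^sup>2)"
    unfolding red_fraction_Suc[of k]
    by (intro Bochner_Integration.integral_cong) (auto simp: algebra_simps)
  also have "\<dots> = expectation (\<lambda>\<omega>. M k \<omega> * (?d \<omega> + step k * (1 - M k \<omega>))\<^sup>2
      + (1 - M k \<omega>) * (?d \<omega> - step k * M k \<omega>)\<^sup>2)"
    by (rule integral_draw_real) (use i1 i2 meas in measurable)
  \<comment> \<open>The cross terms carry the weights \<open>M k * (1 - M k)\<close> and
    \<open>- (1 - M k) * M k\<close>, which cancel.\<close>
  also have "\<dots> = expectation (\<lambda>\<omega>. (?d \<omega>)\<^sup>2 + (step k)\<^sup>2 * V k \<omega>)"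
    by (intro Bochner_Integration.integral_cong refl) algebra
  also have "\<dots> \<le> expectation (\<lambda>\<omega>. (?d \<omega>)\<^sup>2 + (step k)\<^sup>2)"
  proof (rule integral_mono)
    have V: "0 \<le> V k \<omega> \<and> V k \<omega> \<le> 1" for \<omega>
      using red_fraction_bounds[of k \<omega>] by (auto intro!: mult_le_one)
    show "integrable P (\<lambda>\<omega>. (?d \<omega>)\<^sup>2 + (step k)\<^sup>2 * V k \<omega>)"
      using V by (intro Bochner_Integration.integrable_add id integrable_mult_right
          integrable_bounded[where B = 1]) auto
    show "integrable P (\<lambda>\<omega>. (?d \<omega>)\<^sup>2 + (step k)\<^sup>2)" using id by simp
    show "(?d \<omega>)\<^sup>2 + (step k)\<^sup>2 * V k \<omega> \<le> (?d \<omega>)\<^sup>2 + (step k)\<^sup>2" for \<omega>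
      using V[of \<omega>] by (simp add: mult_left_le)
  qed
  also have "\<dots> = expectation (\<lambda>\<omega>. (?d \<omega>)\<^sup>2) + (step k)\<^sup>2" using id by (simp add: prob_space)
  finally show ?case using step.hyps step.IH by simp
qed

text \<open>The second moment is at most \<open>1 / n\<close>; the weight \<open>sqrt n\<close> in
  the pointwise inequality balances its two halves.\<close>

lemma increment_first_moment:
  assumes "1 \<le> n" "n \<le> k"
  shows "expectation (\<lambda>\<omega>. \<bar>M k \<omega> - M n \<omega>\<bar>) \<le> 1 / sqrt n"
proof -
  let ?r = "sqrt (real n)"
  have r: "0 < ?r" using assms by simp
  have sq: "integrable P (\<lambda>\<omega>. (M k \<omega> - M n \<omega>)\<^sup>2)"
    by (rule integrable_bounded[where B = 1])
      (use red_fraction_increment_le_1 in \<open>auto simp: abs_square_le_1\<close>)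
  have "expectation (\<lambda>\<omega>. \<bar>M k \<omega> - M n \<omega>\<bar>) \<le> expectation (\<lambda>\<omega>. (?r * (M k \<omega> - M n \<omega>)\<^sup>2 + 1 / ?r) / 2)"
  proof (rule integral_mono)
    show "integrable P (\<lambda>\<omega>. \<bar>M k \<omega> - M n \<omega>\<bar>)"
      by (rule integrable_bounded[where B = 1]) (use red_fraction_increment_le_1 in auto)
    show "integrable P (\<lambda>\<omega>. (?r * (M k \<omega> - M n \<omega>)\<^sup>2 + 1 / ?r) / 2)" using sq by simp
    \<comment> \<open>AM-GM: \<open>2 \<bar>x\<bar> \<le> r x\<^sup>2 + 1 / r\<close>\<close>
    show "\<bar>M k \<omega> - M n \<omega>\<bar> \<le> (?r * (M k \<omega> - M n \<omega>)\<^sup>2 + 1 / ?r) / 2" for \<omega>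
    proof -
      define x where "x = \<bar>M k \<omega> - M n \<omega>\<bar>"
      have "0 \<le> (?r * x - 1)\<^sup>2 / ?r" using r by simp
      also have "\<dots> = ?r * x\<^sup>2 + 1 / ?r - 2 * x"
        using r by (simp add: divide_simps power2_eq_square) (simp add: algebra_simps)
      finally have "x \<le> (?r * x\<^sup>2 + 1 / ?r) / 2" by simp
      then show ?thesis by (simp add: x_def)
    qed
  qed
  also have "\<dots> = (?r * expectation (\<lambda>\<omega>. (M k \<omega> - M n \<omega>)\<^sup>2) + 1 / ?r) / 2"
    using sq by (simp add: prob_space)
  also have "\<dots> \<le> (?r * (1 / real n) + 1 / ?r) / 2"
    using increment_second_moment[OF assms(2)] sum_step_squares_le[OF assms]
    by (intro divide_right_mono add_mono mult_left_mono) auto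
  also have "?r * (1 / real n) = 1 / ?r" using r by (simp add: real_div_sqrt field_simps)
  finally show ?thesis by simp
qed

section \<open>One-step recursion for the characteristic function\<close>

text \<open>Both \<open>u\<close> and \<open>D\<close> are known at time \<open>n\<close>, hence
  \<open>Z k\<close> is frozen while draw \<open>k + 1\<close> is averaged out. On \<open>D\<close>
  the product of squared frequency and \<open>V n\<close> is the constant \<open>q\<close>, so the
  approximating factor is deterministic and leaves the expectation.\<close>

lemma characteristic_step:
  fixes u :: "'a \<Rightarrow> real"
  assumes nk: "n \<le> k" and u: "u \<in> borel_measurable (past n)" and D: "D \<in> sets (past n)"
    and bound: "\<And>\<omega>. \<omega> \<in> D \<Longrightarrow> \<bar>u \<omega>\<bar> \<le> U" and q: "\<And>\<omega>. \<omega> \<in> D \<Longrightarrow> (u \<omega>)\<^sup>2 * V n \<omega> = q"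
    and "0 \<le> U"
  defines "Z \<equiv> \<lambda>k \<omega>. indicator D \<omega> *\<^sub>R iexp (u \<omega> * (M k \<omega> - M n \<omega>))"
  shows "cmod ((\<integral>\<omega>. Z (Suc k) \<omega> \<partial>P) - of_real (exp (- (q * (step k)\<^sup>2 / 2))) * (\<integral>\<omega>. Z k \<omega> \<partial>P))
    \<le> U ^ 3 * (step k) ^ 3 / 6 + U\<^sup>2 * (step k)\<^sup>2 / 2 * expectation (\<lambda>\<omega>. \<bar>M k \<omega> - M n \<omega>\<bar>)
      + (q * (step k)\<^sup>2 / 2)\<^sup>2 / 2"
proof -
  let ?s = "step k" and ?c = "exp (- (q * (step k)\<^sup>2 / 2))"
  let ?A = "\<lambda>\<omega>. iexp (u \<omega> * ?s * (1 - M k \<omega>))" and ?B = "\<lambda>\<omega>. iexp (- (u \<omega> * ?s * M k \<omega>))"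
  have [measurable]: "u \<in> borel_measurable (past k)" "D \<in> sets (past k)"
      "M n \<in> borel_measurable (past k)" "M k \<in> borel_measurable (past k)"
    using measurable_from_subalg[OF subalgebra_past_mono[OF nk] u]
      subalgebra_past_mono[OF nk] D nk red_fraction_measurable_past
    by (auto simp: subalgebra_def)
  have ZA[measurable]: "(\<lambda>\<omega>. Z k \<omega> * ?A \<omega>) \<in> borel_measurable (past k)"
    and ZB[measurable]: "(\<lambda>\<omega>. Z k \<omega> * ?B \<omega>) \<in> borel_measurable (past k)"
    and Z[measurable]: "Z k \<in> borel_measurable (past k)"
    unfolding Z_def by measurable
  have fromP: "f \<in> borel_measurable P" if "f \<in> borel_measurable (past k)" for f :: "'a \<Rightarrow> complex"
    using measurable_from_subalg[OF subalgebra_past that] .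
  have Zn: "cmod (Z k \<omega>) = indicator D \<omega>" for \<omega> by (simp add: Z_def)
  have iA: "integrable P (\<lambda>\<omega>. Z k \<omega> * ?A \<omega>)"
    by (rule integrable_bounded[where B = 1])
      (use fromP[OF ZA] in \<open>auto simp: norm_mult Zn indicator_def\<close>)
  have iB: "integrable P (\<lambda>\<omega>. Z k \<omega> * ?B \<omega>)"
    by (rule integrable_bounded[where B = 1])
      (use fromP[OF ZB] in \<open>auto simp: norm_mult Zn indicator_def\<close>)
  have iZ: "integrable P (Z k)"
    by (rule integrable_bounded[where B = 1])
      (use fromP[OF Z] in \<open>auto simp: Zn indicator_def\<close>)
  have "(\<integral>\<omega>. Z (Suc k) \<omega> \<partial>P) = (\<integral>\<omega>. (if \<epsilon> (Suc k) \<omega> then Z k \<omega> * ?A \<omega> else Z k \<omega> * ?B \<omega>) \<partial>P)"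
    unfolding Z_def red_fraction_Suc[of k]
    by (intro Bochner_Integration.integral_cong)
      (auto simp: exp_add[symmetric] algebra_simps diff_divide_distrib)
  also have "\<dots> = (\<integral>\<omega>. M k \<omega> *\<^sub>R (Z k \<omega> * ?A \<omega>) + (1 - M k \<omega>) *\<^sub>R (Z k \<omega> * ?B \<omega>) \<partial>P)"
    by (rule integral_draw) (use iA iB in measurable)
  finally have "(\<integral>\<omega>. Z (Suc k) \<omega> \<partial>P) - of_real ?c * (\<integral>\<omega>. Z k \<omega> \<partial>P)
      = (\<integral>\<omega>. M k \<omega> *\<^sub>R (Z k \<omega> * ?A \<omega>) + (1 - M k \<omega>) *\<^sub>R (Z k \<omega> * ?B \<omega>) \<partial>P)
        - (\<integral>\<omega>. of_real ?c * Z k \<omega> \<partial>P)"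
    by simp
  also have "\<dots> = (\<integral>\<omega>. M k \<omega> *\<^sub>R (Z k \<omega> * ?A \<omega>) + (1 - M k \<omega>) *\<^sub>R (Z k \<omega> * ?B \<omega>)
        - of_real ?c * Z k \<omega> \<partial>P)"
    by (rule Bochner_Integration.integral_diff[symmetric])
      (use integrable_draw_average[OF iA iB] iZ in auto)
  finally have eq: "(\<integral>\<omega>. Z (Suc k) \<omega> \<partial>P) - of_real ?c * (\<integral>\<omega>. Z k \<omega> \<partial>P) = \<dots>" .
  let ?E = "\<lambda>\<omega>. U ^ 3 * ?s ^ 3 / 6 + U\<^sup>2 * ?s\<^sup>2 / 2 * \<bar>M k \<omega> - M n \<omega>\<bar> + (q * ?s\<^sup>2 / 2)\<^sup>2 / 2"
  have ia: "integrable P (\<lambda>\<omega>. \<bar>M k \<omega> - M n \<omega>\<bar>)"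
    by (rule integrable_bounded[where B = 1]) (use red_fraction_increment_le_1 in auto)
  have "cmod (\<integral>\<omega>. M k \<omega> *\<^sub>R (Z k \<omega> * ?A \<omega>) + (1 - M k \<omega>) *\<^sub>R (Z k \<omega> * ?B \<omega>)
        - of_real ?c * Z k \<omega> \<partial>P) \<le> (\<integral>\<omega>. ?E \<omega> \<partial>P)"
  proof (rule norm_integral_le)
    show "integrable P (\<lambda>\<omega>. M k \<omega> *\<^sub>R (Z k \<omega> * ?A \<omega>) + (1 - M k \<omega>) *\<^sub>R (Z k \<omega> * ?B \<omega>)
        - of_real ?c * Z k \<omega>)"
      using integrable_draw_average[OF iA iB] iZ by auto
    show "integrable P ?E" using ia by simp
    fix \<omega>
    let ?y = "u \<omega> * ?s"
    have nonneg: "0 \<le> U ^ 3 * ?s ^ 3 / 6" "0 \<le> U\<^sup>2 * ?s\<^sup>2 / 2 * \<bar>M k \<omega> - M n \<omega>\<bar>" "0 \<le> (q * ?s\<^sup>2 / 2)\<^sup>2 / 2"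
      using \<open>0 \<le> U\<close> step_pos[of k] by auto
    \<comment> \<open>The factor \<open>Z k\<close> has modulus \<open>indicator D\<close>, so the
      Bernoulli estimate is needed only on \<open>D\<close>.\<close>
    have "M k \<omega> *\<^sub>R (Z k \<omega> * ?A \<omega>) + (1 - M k \<omega>) *\<^sub>R (Z k \<omega> * ?B \<omega>) - of_real ?c * Z k \<omega>
        = Z k \<omega> * (M k \<omega> *\<^sub>R ?A \<omega> + (1 - M k \<omega>) *\<^sub>R ?B \<omega> - of_real ?c)"
      by (simp add: right_diff_distrib distrib_left mult.commute)
    then have nrm: "cmod (M k \<omega> *\<^sub>R (Z k \<omega> * ?A \<omega>) + (1 - M k \<omega>) *\<^sub>R (Z k \<omega> * ?B \<omega>) - of_real ?c * Z k \<omega>)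
        = indicator D \<omega> * cmod (M k \<omega> *\<^sub>R ?A \<omega> + (1 - M k \<omega>) *\<^sub>R ?B \<omega> - of_real ?c)"
      by (simp only: norm_mult Zn)
    show "cmod (M k \<omega> *\<^sub>R (Z k \<omega> * ?A \<omega>) + (1 - M k \<omega>) *\<^sub>R (Z k \<omega> * ?B \<omega>) - of_real ?c * Z k \<omega>) \<le> ?E \<omega>"
    proof (cases "\<omega> \<in> D")
      case False
      then show ?thesis unfolding nrm using nonneg by simp
    next
      case True
      have c: "q * ?s\<^sup>2 / 2 = ?y\<^sup>2 * V n \<omega> / 2"
        using q[OF True, symmetric] by (simp add: power_mult_distrib power_divide)
      have "cmod (M k \<omega> *\<^sub>R ?A \<omega> + (1 - M k \<omega>) *\<^sub>R ?B \<omega> - of_real ?c)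
          \<le> \<bar>?y\<bar> ^ 3 / 6 + ?y\<^sup>2 / 2 * \<bar>V k \<omega> - V n \<omega>\<bar> + (q * ?s\<^sup>2 / 2)\<^sup>2 / 2"
        unfolding c
        by (rule centred_bernoulli_char_approx) (use red_fraction_bounds in auto)
      also have "\<dots> \<le> ?E \<omega>"
      proof (intro add_mono order_refl mult_mono divide_right_mono)
        have y: "\<bar>?y\<bar> \<le> U * ?s"
          using bound[OF True] step_pos[of k] by (simp add: abs_mult divide_right_mono)
        show "\<bar>?y\<bar> ^ 3 \<le> U ^ 3 * ?s ^ 3"
          using power_mono[OF y, of 3] by (simp add: power_mult_distrib power_divide)
        show "?y\<^sup>2 \<le> U\<^sup>2 * ?s\<^sup>2"
          using power_mono[OF y, of 2] by (simp add: power_mult_distrib power_divide)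
        show "\<bar>V k \<omega> - V n \<omega>\<bar> \<le> \<bar>M k \<omega> - M n \<omega>\<bar>"
          by (rule bernoulli_variance_lipschitz) (use red_fraction_bounds in auto)
      qed auto
      finally show ?thesis unfolding nrm using True by simp
    qed
  qed
  also have "(\<integral>\<omega>. ?E \<omega> \<partial>P) = U ^ 3 * ?s ^ 3 / 6
      + U\<^sup>2 * ?s\<^sup>2 / 2 * expectation (\<lambda>\<omega>. \<bar>M k \<omega> - M n \<omega>\<bar>) + (q * ?s\<^sup>2 / 2)\<^sup>2 / 2"
    using ia by (simp add: prob_space)
  finally show ?thesis unfolding eq .
qed


section \<open>Random frequency, truncation and finite horizon\<close>

lemma variance_bounds: "0 < V n \<omega>" "V n \<omega> \<le> 1"
proof -
  have "0 < M n \<omega>" "M n \<omega> < 1"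
    using red_balls_bounds[of n \<omega>] red_pos white_pos
    by (auto simp: red_fraction_def divide_less_eq_1)
  then show "0 < V n \<omega>" by simp
  show "V n \<omega> \<le> 1" using red_fraction_bounds[of n \<omega>] by (intro mult_le_one) auto
qed

text \<open>Multiplied by the tail increment this gives \<open>t\<close> times the normalised error.
  Its square times \<open>V n\<close> is \<open>t\<^sup>2 * n\<close>, free of
  \<open>\<omega>\<close>.\<close>

definition scale :: "real \<Rightarrow> nat \<Rightarrow> 'a \<Rightarrow> real" where
  "scale t n \<omega> = t * sqrt n / sqrt (V n \<omega>)"

text \<open>The truncation that bounds the random frequency by
  \<open>\<bar>t\<bar> * sqrt n / sqrt \<delta>\<close>.\<close>

definition non_degenerate :: "real \<Rightarrow> nat \<Rightarrow> 'a set" where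
  "non_degenerate \<delta> n = {\<omega> \<in> space P. \<delta> \<le> V n \<omega>}"

lemma scale_measurable: "scale t n \<in> borel_measurable (past n)"
  unfolding scale_def using red_fraction_measurable_past[of n n] by measurable

lemma non_degenerate_sets: "non_degenerate \<delta> n \<in> sets (past n)"
proof -
  have [measurable]: "M n \<in> borel_measurable (past n)" by (simp add: red_fraction_measurable_past)
  have "{\<omega> \<in> space (past n). \<delta> \<le> V n \<omega>} \<in> sets (past n)" by measurable
  then show ?thesis by (simp add: non_degenerate_def)
qed

text \<open>Iterating the one-step recursion from \<open>n\<close> to \<open>N\<close> gives the
  first error term. The second is the cost of replacing the accumulated exponent, which the sums of
  squared steps hold just below \<open>t\<^sup>2 / 2\<close>, by \<open>t\<^sup>2 / 2\<close>
  itself.\<close>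

lemma characteristic_finite_horizon:
  fixes t :: real
  assumes n: "1 \<le> n" "n \<le> N" and \<delta>: "0 < \<delta>" "\<delta> \<le> 1"
  defines "Z \<equiv> \<lambda>k \<omega>. indicator (non_degenerate \<delta> n) \<omega> *\<^sub>R iexp (scale t n \<omega> * (M k \<omega> - M n \<omega>))"
  shows "cmod ((\<integral>\<omega>. Z N \<omega> \<partial>P) - of_real (exp (- (t\<^sup>2 / 2)) * prob (non_degenerate \<delta> n)))
    \<le> char_error_const (\<bar>t\<bar> / sqrt \<delta>) / sqrt n + t\<^sup>2 / 2 * (1 - real n * (step n - step N))"
proof -
  let ?D = "non_degenerate \<delta> n" and ?b = "\<bar>t\<bar> / sqrt \<delta>" and ?q = "t\<^sup>2 * real n"
  let ?c = "\<lambda>k. ?q * (step k)\<^sup>2 / 2" and ?e = "\<lambda>k. (step k)\<^sup>2 * (sqrt n * char_error_const ?b)"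
  have "t * 1 \<le> t / sqrt \<delta>" if "0 \<le> t" for t using that \<delta> by (simp add: field_simps mult_left_le)
  from this[of "\<bar>t\<bar>"] have tb: "\<bar>t\<bar> \<le> ?b" by simp
  have C: "0 \<le> char_error_const ?b" unfolding char_error_const_def using \<delta> by (intro add_nonneg_nonneg) auto
  have bound: "\<bar>scale t n \<omega>\<bar> \<le> ?b * sqrt n" if "\<omega> \<in> ?D" for \<omega>
  proof -
    have "\<bar>scale t n \<omega>\<bar> = \<bar>t\<bar> * sqrt n / sqrt (V n \<omega>)"
      using variance_bounds(1)[of n \<omega>] by (simp add: scale_def abs_mult)
    also have "\<dots> \<le> \<bar>t\<bar> * sqrt n / sqrt \<delta>"
      using that \<delta> by (intro divide_left_mono) (auto simp: non_degenerate_def)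
    finally show ?thesis by simp
  qed
  have q: "(scale t n \<omega>)\<^sup>2 * V n \<omega> = ?q" for \<omega>
  proof -
    have "(sqrt (V n \<omega>))\<^sup>2 = V n \<omega>" using variance_bounds(1)[of n \<omega>] by simp
    then have "(scale t n \<omega>)\<^sup>2 = ?q / V n \<omega>"
      unfolding scale_def power_divide power_mult_distrib by simp
    then show ?thesis using variance_bounds(1)[of n \<omega>] by (metis less_irrefl nonzero_divide_eq_eq)
  qed
  have "cmod ((\<integral>\<omega>. Z N \<omega> \<partial>P) - of_real (exp (- (\<Sum>k=n..<N. ?c k))) * (\<integral>\<omega>. Z n \<omega> \<partial>P))
      \<le> (\<Sum>k=n..<N. ?e k)"
  proof (rule perturbed_geometric_recursion)
    fix k assume k: "n \<le> k"
    have "cmod ((\<integral>\<omega>. Z (Suc k) \<omega> \<partial>P) - of_real (exp (- ?c k)) * (\<integral>\<omega>. Z k \<omega> \<partial>P))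
      \<le> (?b * sqrt n) ^ 3 * (step k) ^ 3 / 6
        + (?b * sqrt n)\<^sup>2 * (step k)\<^sup>2 / 2 * expectation (\<lambda>\<omega>. \<bar>M k \<omega> - M n \<omega>\<bar>) + (?c k)\<^sup>2 / 2"
      unfolding Z_def
      by (rule characteristic_step[OF k scale_measurable non_degenerate_sets bound q])
        (use \<delta> in auto)
    also have "\<dots> \<le> ?e k"
      by (rule characteristic_error_le)
        (use n k tb step_pos[of k] step_le[OF n(1) k] increment_first_moment[OF n(1) k] in auto)
    finally show "cmod ((\<integral>\<omega>. Z (Suc k) \<omega> \<partial>P) - of_real (exp (- ?c k)) * (\<integral>\<omega>. Z k \<omega> \<partial>P)) \<le> ?e k" .
  qed (use n in auto)
  also have "(\<Sum>k=n..<N. ?e k) = (\<Sum>k=n..<N. (step k)\<^sup>2) * (sqrt n * char_error_const ?b)"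
    by (rule sum_distrib_right[symmetric])
  also have "\<dots> \<le> 1 / real n * (sqrt n * char_error_const ?b)"
    using sum_step_squares_le[OF n] C by (intro mult_right_mono) auto
  also have "\<dots> = char_error_const ?b / sqrt n"
    using n by (simp add: field_simps)
  \<comment> \<open>At the starting time the increment vanishes, so only the truncation is
    left.\<close>
  also have "(\<integral>\<omega>. Z n \<omega> \<partial>P) = of_real (prob ?D)"
  proof -
    have "?D \<in> sets P" unfolding non_degenerate_def by measurable
    moreover have "(\<integral>\<omega>. Z n \<omega> \<partial>P) = (\<integral>\<omega>. of_real (indicator ?D \<omega>) \<partial>P)"
      by (intro Bochner_Integration.integral_cong) (auto simp: Z_def indicator_def)
    ultimately show ?thesis by (simp add: integral_complex_of_real)
  qed
  finally have 1: "cmod ((\<integral>\<omega>. Z N \<omega> \<partial>P) - of_real (exp (- (\<Sum>k=n..<N. ?c k)) * prob ?D))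
      \<le> char_error_const ?b / sqrt n" by simp
  have sum_c: "(\<Sum>k=n..<N. ?c k) = ?q / 2 * (\<Sum>k=n..<N. (step k)\<^sup>2)"
    by (simp add: sum_distrib_left)
  have "?q / 2 * (\<Sum>k=n..<N. (step k)\<^sup>2) \<le> ?q / 2 * (1 / real n)"
    using sum_step_squares_le[OF n] by (intro mult_left_mono) auto
  then have le: "(\<Sum>k=n..<N. ?c k) \<le> t\<^sup>2 / 2" unfolding sum_c using n by simp
  have split: "t\<^sup>2 / 2 * (1 - real n * x) = t\<^sup>2 / 2 - ?q / 2 * x" for x
    by (simp add: right_diff_distrib)
  have "?q / 2 * (step n - step N) \<le> ?q / 2 * (\<Sum>k=n..<N. (step k)\<^sup>2)"
    using sum_step_squares_ge[OF n(2)] by (intro mult_left_mono) auto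
  then have "t\<^sup>2 / 2 - ?q / 2 * (\<Sum>k=n..<N. (step k)\<^sup>2) \<le> t\<^sup>2 / 2 - ?q / 2 * (step n - step N)"
    by (rule diff_left_mono)
  then have ge: "t\<^sup>2 / 2 - (\<Sum>k=n..<N. ?c k) \<le> t\<^sup>2 / 2 * (1 - real n * (step n - step N))"
    unfolding sum_c by (simp only: split)
  have "cmod (of_real (exp (- (\<Sum>k=n..<N. ?c k)) * prob ?D) - of_real (exp (- (t\<^sup>2 / 2)) * prob ?D))
      = \<bar>exp (- (\<Sum>k=n..<N. ?c k)) - exp (- (t\<^sup>2 / 2))\<bar> * prob ?D"
    unfolding of_real_diff[symmetric] norm_of_real left_diff_distrib[symmetric] abs_mult by simp
  also have "\<dots> \<le> \<bar>exp (- (\<Sum>k=n..<N. ?c k)) - exp (- (t\<^sup>2 / 2))\<bar>"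
    by (intro mult_left_le) auto
  also have "\<dots> \<le> t\<^sup>2 / 2 - (\<Sum>k=n..<N. ?c k)"
    by (rule exp_minus_lipschitz) (use le in \<open>auto intro!: sum_nonneg\<close>)
  also note ge
  finally show ?thesis using 1 by (intro norm_diff_triangle_le)
qed

section \<open>Uniform control of small variances\<close>

abbreviation "X n \<omega> \<equiv> real (red_balls S \<alpha> \<epsilon> n \<omega>)"

abbreviation "\<tau> n \<equiv> real (total_balls S \<alpha> \<beta> n)"

text \<open>One penalty per colour, because \<open>V n\<close> is the product of the two colour
  fractions and becomes small when either colour is rare.\<close>

definition log_potential :: "nat \<Rightarrow> 'a \<Rightarrow> real" where
  "log_potential n \<omega> = log_penalty S (X n \<omega>) (\<tau> n) + log_penalty S (\<tau> n - X n \<omega>) (\<tau> n)"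

lemma ball_count_bounds: "1 \<le> X n \<omega>" "1 \<le> \<tau> n - X n \<omega>"
  using red_balls_bounds[of n \<omega>] red_pos white_pos by auto

lemma red_balls_measurable: "X n \<in> borel_measurable (past n)"
proof -
  have "0 < \<tau> n" using red_pos by (simp add: total_balls_def add_pos_nonneg)
  then have "X n = (\<lambda>\<omega>. M n \<omega> * \<tau> n)" by (simp add: red_fraction_def)
  then show ?thesis using red_fraction_measurable_past[of n n] by simp
qed

lemma red_balls_measurable' [measurable]: "X n \<in> borel_measurable P"
  using measurable_from_subalg[OF subalgebra_past red_balls_measurable] .

lemma log_potential_ge: "- ln (V n \<omega>) \<le> log_potential n \<omega>"
proof -
  have M: "M n \<omega> = X n \<omega> / \<tau> n" by (simp add: red_fraction_def)
  have M': "1 - M n \<omega> = (\<tau> n - X n \<omega>) / \<tau> n"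
    unfolding M using ball_count_bounds[of n \<omega>] by (simp add: field_simps)
  have "ln (V n \<omega>) = ln (X n \<omega> / \<tau> n) + ln ((\<tau> n - X n \<omega>) / \<tau> n)"
    unfolding M' unfolding M using ball_count_bounds[of n \<omega>] by (intro ln_mult_pos) auto
  then show ?thesis
    using log_penalty_bounds(1)[of S "X n \<omega>" "\<tau> n"] log_penalty_bounds(1)[of S "\<tau> n - X n \<omega>" "\<tau> n"]
      ball_count_bounds[of n \<omega>] S_pos
    unfolding log_potential_def by simp
qed

lemma log_potential_nonneg: "0 \<le> log_potential n \<omega>"
  unfolding log_potential_def using ball_count_bounds[of n \<omega>] S_pos
  by (intro add_nonneg_nonneg log_penalty_bounds) auto

lemma log_potential_integrable: "integrable P (log_potential n)"
proof (rule integrable_bounded)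
  show "log_potential n \<in> borel_measurable P" unfolding log_potential_def log_penalty_def by measurable
  show "norm (log_potential n \<omega>) \<le> (S + ln (\<tau> n)) + (S + ln (\<tau> n))" for \<omega>
  proof -
    have "log_potential n \<omega> \<le> (S + ln (\<tau> n)) + (S + ln (\<tau> n))"
      unfolding log_potential_def using ball_count_bounds[of n \<omega>] S_pos
      by (intro add_mono log_penalty_bounds(3)) auto
    then show ?thesis using log_potential_nonneg[of n \<omega>] by simp
  qed
qed

text \<open>After averaging over the draw, the potential splits by colour and the one-colour drift
  bound applies twice, with the roles of the colours exchanged.\<close>

lemma log_potential_supermartingale:
  "expectation (log_potential (Suc n)) \<le> expectation (log_potential n)"
proof -
  let ?h = "log_penalty S"
  define f where "f \<omega> = ?h (X n \<omega> + S) (\<tau> n + S) + ?h (\<tau> n - X n \<omega>) (\<tau> n + S)" for \<omega>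
  define g where "g \<omega> = ?h (X n \<omega>) (\<tau> n + S) + ?h (\<tau> n - X n \<omega> + S) (\<tau> n + S)" for \<omega>
  have meas: "f \<in> borel_measurable (past n)" "g \<in> borel_measurable (past n)"
    unfolding f_def g_def log_penalty_def using red_balls_measurable[of n] by measurable
  have bnd: "\<bar>f \<omega>\<bar> \<le> (S + ln (\<tau> n + S)) + (S + ln (\<tau> n + S))"
    "\<bar>g \<omega>\<bar> \<le> (S + ln (\<tau> n + S)) + (S + ln (\<tau> n + S))" for \<omega>
  proof -
    have p: "\<bar>?h a (\<tau> n + S)\<bar> \<le> S + ln (\<tau> n + S)" if "1 \<le> a" "a \<le> \<tau> n + S" for a
      using log_penalty_bounds(2,3)[of S a "\<tau> n + S"] that S_pos by simp
    show "\<bar>f \<omega>\<bar> \<le> (S + ln (\<tau> n + S)) + (S + ln (\<tau> n + S))"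
      "\<bar>g \<omega>\<bar> \<le> (S + ln (\<tau> n + S)) + (S + ln (\<tau> n + S))"
      unfolding f_def g_def using ball_count_bounds[of n \<omega>] S_pos
      by (intro order_trans[OF abs_triangle_ineq] add_mono p; simp)+
  qed
  have int: "integrable P f" "integrable P g"
    using meas bnd by (auto intro!: integrable_bounded[where B = "(S + ln (\<tau> n + S)) + (S + ln (\<tau> n + S))"]
        measurable_from_subalg[OF subalgebra_past])
  have \<tau>: "\<tau> (Suc n) = \<tau> n + S" by (simp add: total_balls_def)
  have "expectation (log_potential (Suc n)) = expectation (\<lambda>\<omega>. if \<epsilon> (Suc n) \<omega> then f \<omega> else g \<omega>)"
    by (intro Bochner_Integration.integral_cong)
      (auto simp: log_potential_def f_def g_def red_balls_Suc \<tau> algebra_simps)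
  also have "\<dots> = expectation (\<lambda>\<omega>. M n \<omega> * f \<omega> + (1 - M n \<omega>) * g \<omega>)"
    by (rule integral_draw_real) (use meas int in auto)
  also have "\<dots> \<le> expectation (log_potential n)"
  proof (rule integral_mono)
    have [measurable]: "f \<in> borel_measurable P" "g \<in> borel_measurable P" using int by auto
    have "integrable P (\<lambda>\<omega>. M n \<omega> * f \<omega>)" "integrable P (\<lambda>\<omega>. (1 - M n \<omega>) * g \<omega>)"
      by (rule Bochner_Integration.integrable_bound[OF int(1)]
            Bochner_Integration.integrable_bound[OF int(2)];
          auto simp: abs_mult mult_left_le_one_le red_fraction_bounds)+
    then show "integrable P (\<lambda>\<omega>. M n \<omega> * f \<omega> + (1 - M n \<omega>) * g \<omega>)" by simp
    fix \<omega>
    define x y where "x = X n \<omega>" and "y = \<tau> n - X n \<omega>"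
    have pos: "0 < x" "0 < y" "0 < real S"
      using ball_count_bounds[of n \<omega>] S_pos by (auto simp: x_def y_def)
    have t: "\<tau> n = x + y" "X n \<omega> = x" by (auto simp: x_def y_def)
    have Mx: "M n \<omega> = x / (x + y)" by (simp add: red_fraction_def t)
    have My: "1 - M n \<omega> = y / (x + y)" unfolding Mx using pos by (simp add: field_simps)
    have "M n \<omega> * f \<omega> + (1 - M n \<omega>) * g \<omega>
        = (x / (x + y) * ?h (x + S) (x + y + S) + y / (x + y) * ?h x (x + y + S))
        + (y / (y + x) * ?h (y + S) (y + x + S) + x / (y + x) * ?h y (y + x + S))"
      unfolding My unfolding Mx f_def g_def t by (simp add: algebra_simps)
    also have "\<dots> \<le> ?h x (x + y) + ?h y (y + x)"
      using pos by (intro add_mono log_penalty_drift)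
    also have "\<dots> = log_potential n \<omega>" unfolding log_potential_def t by (simp add: add.commute)
    finally show "M n \<omega> * f \<omega> + (1 - M n \<omega>) * g \<omega> \<le> log_potential n \<omega>" .
  qed (rule log_potential_integrable)
  finally show ?thesis .
qed

text \<open>On the complement \<open>V n < exp (- L)\<close>, so the potential exceeds
  \<open>L\<close>. Markov's inequality and the decreasing expectations give a bound independent of
  \<open>n\<close>.\<close>

lemma degenerate_prob_le:
  assumes "0 < L"
  shows "1 - prob (non_degenerate (exp (- L)) n) \<le> expectation (log_potential 0) / L"
proof -
  have [measurable]: "log_potential n \<in> borel_measurable P" using log_potential_integrable by auto
  have nd: "non_degenerate (exp (- L)) n \<in> events" unfolding non_degenerate_def by measurable
  have "1 - prob (non_degenerate (exp (- L)) n) = prob (space P - non_degenerate (exp (- L)) n)"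
    using prob_compl[OF nd] by simp
  also have "\<dots> \<le> prob {\<omega> \<in> space P. L \<le> log_potential n \<omega>}"
  proof (rule finite_measure_mono)
    show "space P - non_degenerate (exp (- L)) n \<subseteq> {\<omega> \<in> space P. L \<le> log_potential n \<omega>}"
    proof safe
      fix \<omega> assume "\<omega> \<in> space P" "\<omega> \<notin> non_degenerate (exp (- L)) n"
      then have "V n \<omega> < exp (- L)" by (auto simp: non_degenerate_def)
      then have "ln (V n \<omega>) < - L"
        using variance_bounds(1)[of n \<omega>] ln_less_cancel_iff[of "V n \<omega>" "exp (- L)"] by simp
      then show "L \<le> log_potential n \<omega>" using log_potential_ge[of n \<omega>] by simp
    qed
  qed measurable
  also have "\<dots> \<le> expectation (log_potential n) / L"
    by (rule integral_Markov_inequality_measure[where A = "space P"])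
      (use log_potential_integrable log_potential_nonneg assms in auto)
  also have "\<dots> \<le> expectation (log_potential 0) / L"
  proof (rule divide_right_mono)
    show "expectation (log_potential n) \<le> expectation (log_potential 0)"
      by (rule lift_Suc_antimono_le[of "\<lambda>n. expectation (log_potential n)"])
        (auto intro: log_potential_supermartingale)
  qed (use assms in auto)
  finally show ?thesis .
qed

section \<open>Infinite horizon and removal of the truncation\<close>

lemma step_tendsto_0: "step \<longlonglongrightarrow> 0"
proof (rule tendsto_sandwich[where f = "\<lambda>_. 0" and h = "\<lambda>n. 1 / real n"])
  show "\<forall>\<^sub>F n in sequentially. 0 \<le> step n" using step_pos by (intro always_eventually) (auto intro: less_imp_le)
  show "\<forall>\<^sub>F n in sequentially. step n \<le> 1 / real n"
    using step_le by (intro eventually_sequentiallyI[of 1]) auto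
qed (auto intro: lim_1_over_n)

text \<open>Let \<open>N\<close> tend to infinity with \<open>n\<close> fixed: dominated convergence
  handles the integrals, and \<open>step N\<close> vanishes from the bound.\<close>

lemma characteristic_limit:
  fixes t :: real
  assumes Minf[measurable]: "Minf \<in> borel_measurable P"
    and lim: "AE \<omega> in P. (\<lambda>N. M N \<omega>) \<longlonglongrightarrow> Minf \<omega>"
    and n: "1 \<le> n" and \<delta>: "0 < \<delta>" "\<delta> \<le> 1"
  shows "cmod ((\<integral>\<omega>. indicator (non_degenerate \<delta> n) \<omega> *\<^sub>R iexp (scale t n \<omega> * (Minf \<omega> - M n \<omega>)) \<partial>P)
      - of_real (exp (- (t\<^sup>2 / 2)) * prob (non_degenerate \<delta> n)))
    \<le> char_error_const (\<bar>t\<bar> / sqrt \<delta>) / sqrt n + t\<^sup>2 / 2 * (1 - real n * step n)"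
proof (rule tendsto_le[OF trivial_limit_sequentially])
  let ?D = "non_degenerate \<delta> n" and ?C = "char_error_const (\<bar>t\<bar> / sqrt \<delta>) / sqrt n"
  let ?Z = "\<lambda>N \<omega>. indicator ?D \<omega> *\<^sub>R iexp (scale t n \<omega> * (M N \<omega> - M n \<omega>))"
  let ?Zinf = "\<lambda>\<omega>. indicator ?D \<omega> *\<^sub>R iexp (scale t n \<omega> * (Minf \<omega> - M n \<omega>))"
  have [measurable]: "scale t n \<in> borel_measurable P" "?D \<in> events"
    unfolding scale_def non_degenerate_def by measurable
  have "(\<lambda>N. \<integral>\<omega>. ?Z N \<omega> \<partial>P) \<longlonglongrightarrow> (\<integral>\<omega>. ?Zinf \<omega> \<partial>P)"
  proof (rule integral_dominated_convergence[where w = "\<lambda>_. 1"])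
    show "AE \<omega> in P. (\<lambda>N. ?Z N \<omega>) \<longlonglongrightarrow> ?Zinf \<omega>"
      using lim by eventually_elim (intro tendsto_intros)
    show "AE \<omega> in P. norm (?Z N \<omega>) \<le> 1" for N by (auto simp: indicator_def)
  qed measurable
  then show "(\<lambda>N. cmod ((\<integral>\<omega>. ?Z N \<omega> \<partial>P) - of_real (exp (- (t\<^sup>2 / 2)) * prob ?D)))
      \<longlonglongrightarrow> cmod ((\<integral>\<omega>. ?Zinf \<omega> \<partial>P) - of_real (exp (- (t\<^sup>2 / 2)) * prob ?D))"
    by (intro tendsto_intros)
  have "(\<lambda>N. ?C + t\<^sup>2 / 2 * (1 - real n * (step n - step N)))
      \<longlonglongrightarrow> ?C + t\<^sup>2 / 2 * (1 - real n * (step n - 0))"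
    by (intro tendsto_intros step_tendsto_0)
  then show "(\<lambda>N. ?C + t\<^sup>2 / 2 * (1 - real n * (step n - step N)))
      \<longlonglongrightarrow> ?C + t\<^sup>2 / 2 * (1 - real n * step n)" by simp
  show "\<forall>\<^sub>F N in sequentially. cmod ((\<integral>\<omega>. ?Z N \<omega> \<partial>P) - of_real (exp (- (t\<^sup>2 / 2)) * prob ?D))
      \<le> ?C + t\<^sup>2 / 2 * (1 - real n * (step n - step N))"
    using characteristic_finite_horizon[OF n _ \<delta>] by (intro eventually_sequentiallyI[of n])
qed

text \<open>The truncation is removed twice, from the integral and from the factor
  \<open>prob\<close> of the limit value; each removal costs the probability of the complement,
  hence the factor 2.\<close>

lemma characteristic_error:
  fixes t :: real
  assumes Minf[measurable]: "Minf \<in> borel_measurable P"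
    and lim: "AE \<omega> in P. (\<lambda>N. M N \<omega>) \<longlonglongrightarrow> Minf \<omega>"
    and n: "1 \<le> n" and L: "0 < L"
  shows "cmod ((\<integral>\<omega>. iexp (scale t n \<omega> * (Minf \<omega> - M n \<omega>)) \<partial>P) - of_real (exp (- (t\<^sup>2 / 2))))
    \<le> char_error_const (\<bar>t\<bar> / sqrt (exp (- L))) / sqrt n + t\<^sup>2 / 2 * (1 - real n * step n)
      + 2 * (expectation (log_potential 0) / L)"
proof -
  let ?D = "non_degenerate (exp (- L)) n"
  let ?I = "\<lambda>\<omega>. iexp (scale t n \<omega> * (Minf \<omega> - M n \<omega>))"
  have [measurable]: "scale t n \<in> borel_measurable P" and D[measurable]: "?D \<in> events"
    unfolding scale_def non_degenerate_def by measurable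
  have i: "integrable P ?I" "integrable P (\<lambda>\<omega>. indicator ?D \<omega> *\<^sub>R ?I \<omega>)"
    by (rule integrable_bounded[where B = 1]; auto simp: indicator_def)+
  have "cmod ((\<integral>\<omega>. ?I \<omega> \<partial>P) - (\<integral>\<omega>. indicator ?D \<omega> *\<^sub>R ?I \<omega> \<partial>P))
      = cmod (\<integral>\<omega>. ?I \<omega> - indicator ?D \<omega> *\<^sub>R ?I \<omega> \<partial>P)"
    using i by simp
  also have "\<dots> \<le> (\<integral>\<omega>. indicator (space P - ?D) \<omega> \<partial>P)"
  proof (rule norm_integral_le)
    show "integrable P (\<lambda>\<omega>. indicator (space P - ?D) \<omega> :: real)"
      by (rule integrable_bounded[where B = 1]) (auto simp: indicator_def)
  qed (use i in \<open>auto simp: indicator_def\<close>)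
  also have "\<dots> = 1 - prob ?D" using D prob_compl[OF D] by simp
  finally have 1: "cmod ((\<integral>\<omega>. ?I \<omega> \<partial>P) - (\<integral>\<omega>. indicator ?D \<omega> *\<^sub>R ?I \<omega> \<partial>P)) \<le> 1 - prob ?D" .
  have "of_real (exp (- (t\<^sup>2 / 2)) * prob ?D) - of_real (exp (- (t\<^sup>2 / 2)))
      = (of_real (- (exp (- (t\<^sup>2 / 2)) * (1 - prob ?D))) :: complex)"
    by (simp add: right_diff_distrib)
  then have "cmod (of_real (exp (- (t\<^sup>2 / 2)) * prob ?D) - of_real (exp (- (t\<^sup>2 / 2))))
      = exp (- (t\<^sup>2 / 2)) * (1 - prob ?D)"
    by (simp only: norm_of_real) (simp add: abs_mult)
  also have "\<dots> \<le> 1 - prob ?D" by (intro mult_left_le_one_le) auto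
  finally have 2: "cmod (of_real (exp (- (t\<^sup>2 / 2)) * prob ?D) - of_real (exp (- (t\<^sup>2 / 2)))) \<le> 1 - prob ?D" .
  have 3: "cmod ((\<integral>\<omega>. indicator ?D \<omega> *\<^sub>R ?I \<omega> \<partial>P) - of_real (exp (- (t\<^sup>2 / 2)) * prob ?D))
      \<le> char_error_const (\<bar>t\<bar> / sqrt (exp (- L))) / sqrt n + t\<^sup>2 / 2 * (1 - real n * step n)"
    by (rule characteristic_limit[OF Minf lim n]) (use L in auto)
  show ?thesis
    using norm_diff_triangle_le[OF norm_diff_triangle_le[OF 1 3] 2] degenerate_prob_le[OF L, of n]
    by simp
qed

lemma characteristic_tendsto:
  fixes t :: real
  assumes Minf: "Minf \<in> borel_measurable P"
    and lim: "AE \<omega> in P. (\<lambda>N. M N \<omega>) \<longlonglongrightarrow> Minf \<omega>"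
  shows "(\<lambda>n. \<integral>\<omega>. iexp (scale t n \<omega> * (Minf \<omega> - M n \<omega>)) \<partial>P) \<longlonglongrightarrow> of_real (exp (- (t\<^sup>2 / 2)))"
proof (rule tendstoI)
  fix e :: real assume e: "0 < e"
  let ?K = "expectation (log_potential 0)"
  have K: "0 \<le> ?K" by (intro Bochner_Integration.integral_nonneg) (rule log_potential_nonneg)
  \<comment> \<open>Chosen before \<open>n\<close>, this makes the truncation error at most
    \<open>e / 2\<close> for all \<open>n\<close>; the added 1 keeps \<open>L\<close> positive even
    if \<open>?K\<close> is 0.\<close>
  define L where "L = 4 * (?K + 1) / e"
  have L: "0 < L" using K e by (simp add: L_def)
  have "2 * (?K / L) = e / 2 * (?K / (?K + 1))" using K e by (simp add: L_def field_simps)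
  also have "\<dots> \<le> e / 2 * 1" using K e by (intro mult_left_mono) auto
  finally have KL: "2 * (?K / L) \<le> e / 2" by simp
  let ?r = "\<lambda>n. char_error_const (\<bar>t\<bar> / sqrt (exp (- L))) / sqrt n + t\<^sup>2 / 2 * (1 - real n * step n)"
  \<comment> \<open>The numerator \<open>T (Suc n) - n\<close> is the constant
    \<open>1 + T 0\<close>, so the error from the exponent vanishes like the step.\<close>
  have step: "1 - real n * step n = (1 + T 0) * step n" for n
    using T_eq[of "Suc n"] T_pos[of "Suc n"] by (simp add: field_simps)
  have "?r \<longlonglongrightarrow> 0 + t\<^sup>2 / 2 * ((1 + T 0) * 0)"
    unfolding step
    by (intro tendsto_intros step_tendsto_0 tendsto_divide_0[OF tendsto_const]
        filterlim_at_top_imp_at_infinity filterlim_compose[OF sqrt_at_top] filterlim_real_sequentially)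
  then have "\<forall>\<^sub>F n in sequentially. ?r n < e / 2" using e by (intro order_tendstoD(2)) auto
  then show "\<forall>\<^sub>F n in sequentially.
      dist (\<integral>\<omega>. iexp (scale t n \<omega> * (Minf \<omega> - M n \<omega>)) \<partial>P) (of_real (exp (- (t\<^sup>2 / 2)))) < e"
    using eventually_ge_at_top[of 1]
  proof eventually_elim
    case (elim n)
    then show ?case
      using characteristic_error[OF Minf lim elim(2) L, of t] KL unfolding dist_norm by linarith
  qed
qed

end

section \<open>Convergence in distribution by Levy continuity\<close>

theorem theorem2p3:
  fixes P :: "'a measure" and S \<alpha> \<beta> :: nat
    and \<epsilon> :: "nat \<Rightarrow> 'a \<Rightarrow> bool" and Minf :: "'a \<Rightarrow> real"
  assumes "S \<ge> 1" and "\<alpha> \<ge> 1" and "\<beta> \<ge> 1"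
    and "polya_urn P S \<alpha> \<beta> \<epsilon>"
    and "Minf \<in> borel_measurable P"
    and "AE \<omega> in P. (\<lambda>n. red_fraction S \<alpha> \<beta> \<epsilon> n \<omega>) \<longlonglongrightarrow> Minf \<omega>"
  shows "weak_conv_m
    (\<lambda>n. distr P borel
      (\<lambda>\<omega>. sqrt (real n) * ((Minf \<omega> - red_fraction S \<alpha> \<beta> \<epsilon> n \<omega>)
         / sqrt (red_fraction S \<alpha> \<beta> \<epsilon> n \<omega> * (1 - red_fraction S \<alpha> \<beta> \<epsilon> n \<omega>)))))
    std_normal_distribution"
proof -
  interpret polya_urn P S \<alpha> \<beta> \<epsilon> by fact
  interpret two_coloured_urn P S \<alpha> \<beta> \<epsilon> by unfold_locales (use assms in auto)
  note [measurable] = assms(5)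
  let ?G = "\<lambda>n \<omega>. sqrt (real n) * ((Minf \<omega> - M n \<omega>) / sqrt (V n \<omega>))"
  show ?thesis
  proof (rule levy_continuity)
    show "real_distribution (distr P borel (?G n))" for n by (intro real_distribution_distr) measurable
    show "real_distribution std_normal_distribution" by (rule real_dist_normal_dist)
    fix t :: real
    \<comment> \<open>Absorbing \<open>t\<close> and the normalisation into \<open>scale\<close>
      identifies the characteristic function with the integral whose limit is known.\<close>
    have "char (distr P borel (?G n)) t = (\<integral>\<omega>. iexp (scale t n \<omega> * (Minf \<omega> - M n \<omega>)) \<partial>P)" for n
    proof -
      have "char (distr P borel (?G n)) t = (\<integral>\<omega>. iexp (t * ?G n \<omega>) \<partial>P)"
        unfolding char_def by (rule integral_distr) measurable
      then show ?thesis by (simp add: scale_def mult.assoc)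
    qed
    then show "(\<lambda>n. char (distr P borel (?G n)) t) \<longlonglongrightarrow> char std_normal_distribution t"
      using characteristic_tendsto[OF assms(5,6), of t] by (simp add: char_std_normal_distribution)
  qed
qed

end
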